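(* A complete system of representatives of $\mathbb{Z}^2/\sim$ (i.e. a subset of $\mathbb{Z}^2$ containing exactly one element of each $\sim$-class) is given by the disjoint union $$\{(x,x)\mid x\in\mathbb{Z}\}\sqcup\{(x,y)\in\mathbb{Z}^2\mid 0\le 2x<y\}\sqcup\{(x,y)\in\mathbb{Z}^2\mid 0\le 2y<x\}.$$
   Context: The 2-braid group $B_2$ is the infinite cyclic group generated by $\sigma_1$. It acts on $\mathbb{Z}^2$ on the right by the Hurwitz action $(a_1,a_2)\cdot\sigma_1=(a_2,2a_2-a_1)$. For $v,w\in\mathbb{Z}^2$, $v\sim w$ means that $v\cdot\beta=w$ for some $\beta\in B_2$. *)

theory Defs
  imports "HOL-Algebra.Elementary_Groups"
begin

text \<open>The braid group on two strands is infinite cyclic, generated by \<open>\<sigma>\<^sub>1\<close>. It is modelled by the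
  library's additive group of integers: the integer \<open>k\<close> stands for the braid \<open>\<sigma>\<^sub>1\<close> to the power \<open>k\<close>.\<close>

definition braid_group2 :: "int monoid" where
  "braid_group2 = integer_group"

definition sigma1 :: int where
  "sigma1 = 1"

lemma braid_group2_infinite_cyclic:
  "group braid_group2" "sigma1 \<in> carrier braid_group2"
  "carrier braid_group2 = generate braid_group2 {sigma1}"
  "infinite (carrier braid_group2)"
proof -
  show g: "group braid_group2"
    by (simp add: braid_group2_def)
  show s: "sigma1 \<in> carrier braid_group2"
    by (simp add: braid_group2_def)
  interpret group braid_group2 by (rule g)
  have "\<exists>n::int. k = sigma1 [^]\<^bsub>braid_group2\<^esub> n" for k
    by (rule exI[of _ k]) (simp add: braid_group2_def sigma1_def group_int_pow_integer_group)
  then show "carrier braid_group2 = generate braid_group2 {sigma1}"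
    using generate_pow[OF s] by (auto simp: braid_group2_def)
  show "infinite (carrier braid_group2)"
    by (simp add: braid_group2_def infinite_UNIV_int)
qed

fun hurwitz_step :: "int \<times> int \<Rightarrow> int \<times> int" where
  "hurwitz_step (a1, a2) = (a2, 2 * a2 - a1)"

text \<open>\<open>hurwitz_act v k\<close> is \<open>v \<cdot> \<beta>\<close> where \<open>\<beta>\<close> is \<open>\<sigma>\<^sub>1\<close> to the power \<open>k\<close>; negative powers of
  \<open>\<sigma>\<^sub>1\<close> act by powers of the inverse permutation.\<close>

definition hurwitz_act :: "int \<times> int \<Rightarrow> int \<Rightarrow> int \<times> int" (infixl "\<cdot>\<^sub>H" 70) where
  "v \<cdot>\<^sub>H k =
    (if k \<ge> 0 then (hurwitz_step ^^ nat k) v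
     else (inv_into UNIV hurwitz_step ^^ nat (- k)) v)"

definition hurwitz_equiv :: "int \<times> int \<Rightarrow> int \<times> int \<Rightarrow> bool" (infix "\<sim>\<^sub>H" 50) where
  "v \<sim>\<^sub>H w \<longleftrightarrow> (\<exists>\<beta> \<in> carrier braid_group2. v \<cdot>\<^sub>H \<beta> = w)"

definition hurwitz_rel :: "((int \<times> int) \<times> (int \<times> int)) set" where
  "hurwitz_rel = {(v, w). v \<sim>\<^sub>H w}"

definition complete_representatives :: "'a set \<Rightarrow> ('a \<times> 'a) set \<Rightarrow> 'a set \<Rightarrow> bool" where
  "complete_representatives A r R \<longleftrightarrow> R \<subseteq> A \<and> (\<forall>C \<in> A // r. \<exists>!v. v \<in> C \<inter> R)"

lemma bij_hurwitz_step: "bij hurwitz_step"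
  by (rule bij_betw_byWitness[where f' = "\<lambda>(a, b). (2 * a - b, a)"]) auto

lemma inv_hurwitz_step: "inv_into UNIV hurwitz_step (a, b) = (2 * a - b, a)"
proof -
  have "(a, b) = hurwitz_step (2 * a - b, a)" by simp
  then show ?thesis
    by (metis bij_hurwitz_step bij_is_inj inv_f_f)
qed

lemma hurwitz_act_closed_form: "(a, b) \<cdot>\<^sub>H k = (a + k * (b - a), b + k * (b - a))"
proof -
  have pos: "(hurwitz_step ^^ n) (a, b) = (a + int n * (b - a), b + int n * (b - a))" for n
    by (induction n) (auto simp: algebra_simps)
  have neg: "(inv_into UNIV hurwitz_step ^^ n) (a, b) = (a - int n * (b - a), b - int n * (b - a))" for n
    by (induction n) (auto simp: inv_hurwitz_step algebra_simps)
  show ?thesis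
    by (auto simp: hurwitz_act_def pos neg)
qed

lemma hurwitz_act_right_action:
  "v \<cdot>\<^sub>H \<one>\<^bsub>braid_group2\<^esub> = v"
  "v \<cdot>\<^sub>H (\<beta> \<otimes>\<^bsub>braid_group2\<^esub> \<gamma>) = (v \<cdot>\<^sub>H \<beta>) \<cdot>\<^sub>H \<gamma>"
  "(a1, a2) \<cdot>\<^sub>H sigma1 = (a2, 2 * a2 - a1)"
  by (cases v; simp add: braid_group2_def sigma1_def hurwitz_act_closed_form algebra_simps)+

lemma equiv_hurwitz_rel: "equiv UNIV hurwitz_rel"
proof (rule equivI)
  show "hurwitz_rel \<subseteq> UNIV \<times> UNIV" by simp
  show "refl hurwitz_rel"
    using hurwitz_act_right_action(1)
    by (auto simp: refl_on_def hurwitz_rel_def hurwitz_equiv_def braid_group2_def)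
  show "sym hurwitz_rel"
  proof (rule symI)
    fix v w assume "(v, w) \<in> hurwitz_rel"
    then obtain k where k: "w = v \<cdot>\<^sub>H k"
      by (auto simp: hurwitz_rel_def hurwitz_equiv_def)
    have "w \<cdot>\<^sub>H (- k) = v"
      unfolding k by (cases v) (simp add: hurwitz_act_closed_form)
    then show "(w, v) \<in> hurwitz_rel"
      by (auto simp: hurwitz_rel_def hurwitz_equiv_def braid_group2_def)
  qed
  show "trans hurwitz_rel"
  proof (rule transI)
    fix u v w assume "(u, v) \<in> hurwitz_rel" "(v, w) \<in> hurwitz_rel"
    then show "(u, w) \<in> hurwitz_rel"
      unfolding hurwitz_rel_def hurwitz_equiv_def
      by (auto simp: braid_group2_def) (metis hurwitz_act_right_action(2) braid_group2_def)
  qed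
qed

end

(* The difference d = b - a is invariant along an orbit, and the braid sigma_1^k shifts both entries of
   (a, b) by k d. If d = 0 the orbit is a single diagonal point; otherwise the smaller entry ranges over
   a full residue class modulo |d|. Since 0 \<le> 2x < y says exactly 0 \<le> x < y - x, the
   representatives with d \<noteq> 0 are the pairs whose smaller entry is its own remainder modulo |d|. *)

theory Submission
  imports Defs
begin

text \<open>The exponent of the braid is the quotient of \<open>c - a\<close> by
  \<open>b - a\<close>. For \<open>a = b\<close> the condition reads \<open>0 dvd c - a\<close>,
  which forces \<open>c = a\<close>.\<close>

lemma hurwitz_equiv_iff: "(a, b) \<sim>\<^sub>H (c, d) \<longleftrightarrow> d - c = b - a \<and> (b - a) dvd (c - a)"
proof
  assume "(a, b) \<sim>\<^sub>H (c, d)"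
  then show "d - c = b - a \<and> (b - a) dvd (c - a)"
    by (auto simp: hurwitz_equiv_def hurwitz_act_closed_form)
next
  assume *: "d - c = b - a \<and> (b - a) dvd (c - a)"
  then obtain k where "c - a = (b - a) * k" by (auto elim: dvdE)
  with * have "(a, b) \<cdot>\<^sub>H k = (c, d)"
    by (simp add: hurwitz_act_closed_form algebra_simps)
  then show "(a, b) \<sim>\<^sub>H (c, d)"
    by (auto simp: hurwitz_equiv_def braid_group2_def)
qed

text \<open>The orbit point whose smaller entry lies in [0, |b - a|), in the same order of entries
  as (a, b); diagonal points stay fixed.\<close>

fun hurwitz_normal :: "int \<times> int \<Rightarrow> int \<times> int" where
  "hurwitz_normal (a, b) =
    (if a = b then (a, b)
     else if a < b then (a mod (b - a), a mod (b - a) + (b - a))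
     else (b mod (a - b) + (a - b), b mod (a - b)))"

lemma hurwitz_equiv_normal: "v \<sim>\<^sub>H hurwitz_normal v"
proof -
  obtain a b where v: "v = (a, b)" by fastforce
  have "(b - a) dvd (a mod (b - a) - a)"
    using mod_eq_dvd_iff[of "a mod (b - a)" "b - a" a] by simp
  \<comment> \<open>Case \<open>b < a\<close>: the reduced entry is the second, and the change of
    the first entry simplifies to \<open>b mod (a - b) - b\<close>.\<close>
  moreover have "(b - a) dvd (b mod (a - b) + (a - b) - a)"
  proof -
    have "(a - b) dvd (b mod (a - b) - b)"
      using mod_eq_dvd_iff[of "b mod (a - b)" "a - b" b] by simp
    then have "- (b - a) dvd (b mod (a - b) + (a - b) - a)" by simp
    then show ?thesis by (simp only: minus_dvd_iff)
  qed
  ultimately show ?thesis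
    by (auto simp: v hurwitz_equiv_iff)
qed

text \<open>Equivalent pairs share the difference \<open>e\<close>, and their entries differ by
  multiples of \<open>e\<close>, so the remainders agree.\<close>

lemma hurwitz_normal_cong:
  assumes "v \<sim>\<^sub>H w"
  shows "hurwitz_normal v = hurwitz_normal w"
proof -
  obtain a b c d where vw: "v = (a, b)" "w = (c, d)" by fastforce
  define e where "e = b - a"
  from assms have "d - c = e" and dvd: "e dvd (c - a)"
    by (simp_all add: vw hurwitz_equiv_iff e_def)
  then have b: "b = a + e" and d: "d = c + e" by (simp_all add: e_def)
  have 1: "a mod e = c mod e"
    using dvd by (simp add: mod_eq_dvd_iff dvd_diff_commute)
  \<comment> \<open>For negative \<open>e\<close> the smaller entry is the second one and the
    modulus is \<open>- e\<close>.\<close>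
  have "(- e) dvd ((a + e) - (c + e))"
    using dvd by (simp add: dvd_diff_commute)
  then have 2: "(a + e) mod (- e) = (c + e) mod (- e)"
    by (simp only: mod_eq_dvd_iff)
  have "a = c" if "e = 0" using dvd that by simp
  with 1 2 show ?thesis
    by (simp add: vw b d)
qed

theorem proposition3p3:
  fixes D U L :: "(int \<times> int) set"
  defines "D \<equiv> {(x, x) | x. True}"
    and "U \<equiv> {(x, y). 0 \<le> 2 * x \<and> 2 * x < y}"
    and "L \<equiv> {(x, y). 0 \<le> 2 * y \<and> 2 * y < x}"
  shows "D \<inter> U = {} \<and> D \<inter> L = {} \<and> U \<inter> L = {} \<and>
    complete_representatives UNIV hurwitz_rel (D \<union> U \<union> L)"
proof (intro conjI)
  show "D \<inter> U = {}" "D \<inter> L = {}" "U \<inter> L = {}"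
    by (auto simp: D_def U_def L_def)
  have normal_in: "hurwitz_normal v \<in> D \<union> U \<union> L" for v
  proof -
    obtain a b where v: "v = (a, b)" by fastforce
    consider "a = b" | "a < b" | "b < a" by linarith
    then show ?thesis
    proof cases
      case 1
      then show ?thesis by (simp add: v D_def)
    next
      case 2
      then show ?thesis
        using pos_mod_bound[of "b - a" a] pos_mod_sign[of "b - a" a] by (simp add: v U_def)
    next
      case 3
      then show ?thesis
        using pos_mod_bound[of "a - b" b] pos_mod_sign[of "a - b" b] by (simp add: v L_def)
    qed
  qed
  \<comment> \<open>On \<open>U\<close> and \<open>L\<close> the smaller entry already lies below
    the modulus, so \<open>mod\<close> leaves it unchanged.\<close>
  have normal_fix: "hurwitz_normal v = v" if "v \<in> D \<union> U \<union> L" for v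
    using that by (auto simp: D_def U_def L_def mod_pos_pos_trivial)
  show "complete_representatives UNIV hurwitz_rel (D \<union> U \<union> L)"
    unfolding complete_representatives_def
  proof (intro conjI ballI)
    show "D \<union> U \<union> L \<subseteq> UNIV" by simp
    fix C assume "C \<in> UNIV // hurwitz_rel"
    then obtain v where C: "C = hurwitz_rel `` {v}" by (rule quotientE)
    show "\<exists>!w. w \<in> C \<inter> (D \<union> U \<union> L)"
    proof (rule ex1I)
      show "hurwitz_normal v \<in> C \<inter> (D \<union> U \<union> L)"
        using normal_in hurwitz_equiv_normal by (simp add: C hurwitz_rel_def)
    next
      fix w assume w: "w \<in> C \<inter> (D \<union> U \<union> L)"
      then have "v \<sim>\<^sub>H w" by (simp add: C hurwitz_rel_def)
      \<comment> \<open>\<open>w\<close> is its own normal form, and normal forms are constant on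
        classes.\<close>
      then show "w = hurwitz_normal v"
        using hurwitz_normal_cong normal_fix w by (metis IntD2)
    qed
  qed
qed

end
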